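(* Let $q=6m$ where $m$ is a positive odd integer. Then $N(4,q,1)=\dfrac{q^2(q+2)}{4}$.
   Context: $B_q=\{0,\dots,q-1\}$ and $B_q^4$ is the set of words of length 4 over $B_q$. $N(4,q,1)$ is the maximum cardinality of a code $C\subseteq B_q^4$ capable of correcting single deletions, i.e. such that the sets $\lfloor x\rfloor_1$ ($x\in C$) of words obtained from $x$ by deleting one letter are pairwise disjoint (equivalently, the minimum deletion–insertion distance between distinct codewords exceeds 2). *)

theory Defs
  imports Main "HOL-Library.Sublist"
begin

definition words :: "nat \<Rightarrow> nat \<Rightarrow> nat list set" where
  "words n q = {x. length x = n \<and> set x \<subseteq> {0..<q}}"

definition del_ball :: "nat list \<Rightarrow> nat \<Rightarrow> nat list set" where
  "del_ball x s = {y. subseq y x \<and> length y = length x - s}"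

definition del_correcting :: "nat \<Rightarrow> nat list set \<Rightarrow> bool" where
  "del_correcting s C \<longleftrightarrow> (\<forall>x\<in>C. \<forall>y\<in>C. x \<noteq> y \<longrightarrow> del_ball x s \<inter> del_ball y s = {})"

definition N :: "nat \<Rightarrow> nat \<Rightarrow> nat \<Rightarrow> nat" where
  "N n q s = Max {card C | C. C \<subseteq> words n q \<and> del_correcting s C}"

end

theory Submission
  imports Defs
begin

text \<open>
  Upper bound. Give the word \<open>abc\<close> the weight 1, increased by 1 for each of the coincidences \<open>a = b\<close>,
  \<open>b = c\<close>, \<open>a = b = c\<close>. Every deletion ball has weight at least 4, and the excess is at least the number
  of letters \<open>a\<close> for which the ball contains an odd number of words \<open>aba\<close>. As \<open>q - 1\<close> is odd, each
  letter \<open>a\<close> has either a codeword of this kind or an uncovered word \<open>aba\<close>, so a total weight of at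
  least \<open>q\<close> is lost from the sum \<open>q\<^sup>3 + 2 q\<^sup>2 + q\<close> of all weights.

  Construction. Let \<open>q = 2 n\<close> with \<open>n = 3 m\<close> odd, and let the letters be pairs of a residue modulo \<open>n\<close>
  and a bit. Apart from the words \<open>aabb\<close>, almost all codewords have residues forming a possibly
  degenerate parallelogram \<open>p + p' = r + r'\<close>. Three residues have three completions to a
  parallelogram, and the bits (if they are all equal, the differences of the residues) select one of
  these. This fails exactly if the three residues lie in a coset
  of the subgroup of order 3; each coset carries 6 letters and is served by an optimal code for
  \<open>q = 6\<close>.
\<close>

section \<open>Upper bound\<close>

text \<open>The letter type is arbitrary: letters are natural numbers in the upper bound and pairs
  in the construction.\<close>

fun deletions :: "'a list \<Rightarrow> 'a list set" where
  "deletions [a, b, c, d] = {[b, c, d], [a, c, d], [a, b, d], [a, b, c]}"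
| "deletions _ = {}"

lemma deletions_cases:
  assumes "y \<in> deletions [p, q, r, s]"
  obtains "y = [q, r, s]" | "y = [p, r, s]" | "y = [p, q, s]" | "y = [p, q, r]"
  using assms by auto

lemma deletions_map: "deletions (map f w) = map f ` deletions w"
  by (induction w rule: deletions.induct) simp_all

lemma deletionsI:
  assumes "subseq y w" "length w = 4" "length y = 3"
  shows "y \<in> deletions w"
proof -
  obtain p q r s where w: "w = [p, q, r, s]"
    using assms(2) by (auto simp: length_Suc_conv numeral_eq_Suc)
  obtain a b c where y: "y = [a, b, c]"
    using assms(3) by (auto simp: length_Suc_conv numeral_eq_Suc)
  show ?thesis using assms(1) unfolding w y by (auto split: if_splits)
qed

lemma del_ball_eq_deletions:
  assumes "length x = 4" shows "del_ball x 1 = deletions x"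
proof -
  obtain p q r s where x: "x = [p, q, r, s]"
    using assms by (auto simp: length_Suc_conv numeral_eq_Suc)
  have "y \<in> deletions x" if "y \<in> del_ball x 1" for y
  proof -
    have "length y = 3" using that x by (simp add: del_ball_def)
    then obtain a b c where y: "y = [a, b, c]"
      by (auto simp: length_Suc_conv numeral_eq_Suc)
    show ?thesis using that unfolding x y by (auto simp: del_ball_def split: if_splits)
  qed
  moreover have "y \<in> del_ball x 1" if "y \<in> deletions x" for y
    using that unfolding x by (auto simp: del_ball_def)
  ultimately show ?thesis by blast
qed

text \<open>The values 4, 2 and 1 for \<open>aaa\<close>, \<open>aab\<close> and \<open>aba\<close>
  let small balls keep weight 4: \<open>aaaa\<close> yields only \<open>aaa\<close>, and
  \<open>aabb\<close> only \<open>aab\<close> and \<open>abb\<close>.\<close>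

fun weight :: "nat list \<Rightarrow> nat" where
  "weight [a, b, c] = 1 + of_bool (a = b) + of_bool (b = c) + of_bool (a = b \<and> b = c)"
| "weight _ = 1"

text \<open>With \<open>b = a\<close> excluded, each \<open>a\<close> has \<open>q - 1\<close>
  candidates for \<open>b\<close>, an odd number when \<open>q\<close> is even.\<close>

definition flanked :: "nat list \<Rightarrow> nat \<Rightarrow> nat set" where
  "flanked x a = {b. b \<noteq> a \<and> [a, b, a] \<in> deletions x}"

text \<open>Only the pattern of equalities among the four letters matters, so finitely many cases
  remain. Parity is what can be charged: for distinct letters the ball of \<open>abca\<close>
  contains both \<open>aba\<close> and \<open>aca\<close> but weighs just 4.\<close>

lemma weight_deletions:
  assumes "length x = 4"
  shows "4 + card {e. odd (card (flanked x e))} \<le> sum weight (deletions x)"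
proof -
  obtain a b c d where x: "x = [a, b, c, d]"
    using assms by (auto simp: length_Suc_conv numeral_eq_Suc)
  have f: "flanked x e =
    (if e = b \<and> b = d \<and> c \<noteq> e then {c} else {}) \<union> (if e = a \<and> a = d \<and> c \<noteq> e then {c} else {}) \<union>
    (if e = a \<and> a = d \<and> b \<noteq> e then {b} else {}) \<union> (if e = a \<and> a = c \<and> b \<noteq> e then {b} else {})" for e
  proof -
    have "z \<in> (if P then {y} else {}) \<longleftrightarrow> P \<and> z = y" for P and y z :: nat by simp
    then show ?thesis unfolding flanked_def x set_eq_iff Un_iff by simp blast
  qed
  \<comment> \<open>Every word in the ball begins with \<open>a\<close> or \<open>b\<close>.\<close>
  have "e = a \<or> e = b" if "odd (card (flanked x e))" for e
  proof (rule ccontr)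
    assume "\<not> (e = a \<or> e = b)"
    then have "flanked x e = {}" by (simp add: f)
    with that show False by simp
  qed
  then have odd_eq: "{e. odd (card (flanked x e))} =
    (if odd (card (flanked x a)) then {a} else {}) \<union> (if odd (card (flanked x b)) then {b} else {})"
    by auto
  show ?thesis
    unfolding odd_eq unfolding f unfolding x
    by (cases "a = b"; cases "a = c"; cases "a = d"; cases "b = c"; cases "b = d"; cases "c = d"; simp)
qed

lemma sum_weight: "sum weight (words 3 q) = q ^ 3 + 2 * q\<^sup>2 + q"
proof -
  have "words 3 q = (\<lambda>(a, b, c). [a, b, c]) ` ({..<q} \<times> {..<q} \<times> {..<q})"
    by (force simp: words_def length_Suc_conv numeral_eq_Suc)
  moreover have "inj_on (\<lambda>(a, b, c). [a, b, c]) ({..<q} \<times> {..<q} \<times> {..<q})"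
    by (auto intro!: inj_onI)
  ultimately have "sum weight (words 3 q) = (\<Sum>(a, b, c) \<in> {..<q} \<times> {..<q} \<times> {..<q}. weight [a, b, c])"
    by (simp only: sum.reindex) (auto intro: sum.cong)
  also have "\<dots> = (\<Sum>a<q. \<Sum>b<q. \<Sum>c<q. weight [a, b, c])"
    by (simp only: sum.cartesian_product)
  also have "\<dots> = (\<Sum>a<q. \<Sum>b<q. q + 1 + (if a = b then q + 1 else 0))"
  proof (intro sum.cong refl)
    fix a b assume "a \<in> {..<q}" "b \<in> {..<q}"
    then show "(\<Sum>c<q. weight [a, b, c]) = q + 1 + (if a = b then q + 1 else 0)"
      by (cases "a = b") (simp_all add: sum.distrib sum_Suc of_bool_def)
  qed
  also have "\<dots> = (\<Sum>a<q. q * q + q + q + 1)"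
    by (intro sum.cong refl) (simp only: sum.distrib sum.delta' sum_constant finite_lessThan, simp)
  also have "\<dots> = q ^ 3 + 2 * q\<^sup>2 + q"
    by (simp add: power2_eq_square power3_eq_cube algebra_simps)
  finally show ?thesis .
qed

lemma finite_words: "finite (words n q)"
  unfolding words_def by (rule finite_subset [OF _ finite_lists_length_eq [of "{0..<q}" n]]) auto

lemma code_upper_bound:
  assumes "even q" "q > 0" and C: "C \<subseteq> words 4 q" and corr: "del_correcting 1 C"
  shows "4 * card C \<le> q ^ 3 + 2 * q\<^sup>2"
proof -
  define U where "U = (\<Union>x\<in>C. deletions x)"
  define odds where "odds a = {x \<in> C. odd (card (flanked x a))}" for a
  define missed where "missed a = {b \<in> {..<q}. b \<noteq> a \<and> [a, b, a] \<notin> U}" for a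
  have finC: "finite C" using C finite_words finite_subset by blast
  have len: "length x = 4" if "x \<in> C" for x using that C by (auto simp: words_def)
  have fin: "finite (deletions x)" for x :: "nat list"
    by (induction x rule: deletions.induct) simp_all
  have disj: "deletions x \<inter> deletions y = {}" if "x \<in> C" "y \<in> C" "x \<noteq> y" for x y
    using corr that len unfolding del_correcting_def by (metis del_ball_eq_deletions)
  have U: "U \<subseteq> words 3 q"
  proof
    fix y assume "y \<in> U"
    then obtain x where "x \<in> C" "y \<in> deletions x" by (auto simp: U_def)
    moreover then obtain a b c d where "x = [a, b, c, d]"
      using len by (fastforce simp: length_Suc_conv numeral_eq_Suc)
    ultimately show "y \<in> words 3 q" using C by (fastforce simp: words_def)
  qed
  have fl: "flanked x a \<subseteq> {b \<in> {..<q}. b \<noteq> a}" if "x \<in> C" for x a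
  proof
    fix b assume b: "b \<in> flanked x a"
    then have "[a, b, a] \<in> U" using that by (auto simp: flanked_def U_def)
    then show "b \<in> {b \<in> {..<q}. b \<noteq> a}" using U b by (auto simp: words_def flanked_def)
  qed
  have fl': "a < q" if "x \<in> C" "odd (card (flanked x a))" for x a
  proof -
    have "flanked x a \<noteq> {}" using that(2) by auto
    then obtain b where "b \<in> flanked x a" by blast
    then have "[a, b, a] \<in> U" using that by (auto simp: flanked_def U_def)
    then show ?thesis using U by (auto simp: words_def)
  qed
  \<comment> \<open>Otherwise the codewords would split the \<open>q - 1\<close> letters other than
    \<open>a\<close> into sets of even size; these are disjoint, since a common \<open>b\<close>
    would mean a common deletion \<open>aba\<close>.\<close>
  have parity: "1 \<le> card (odds a) + card (missed a)" if a: "a < q" for a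
  proof (rule ccontr)
    assume "\<not> 1 \<le> card (odds a) + card (missed a)"
    then have "card (odds a) = 0" "card (missed a) = 0" by simp_all
    then have "odds a = {}" "missed a = {}" using finC by (simp_all add: odds_def missed_def)
    then have ev: "even (\<Sum>x\<in>C. card (flanked x a))"
      and all: "\<And>b. b < q \<Longrightarrow> b \<noteq> a \<Longrightarrow> [a, b, a] \<in> U"
      by (auto simp: odds_def missed_def intro!: dvd_sum)
    have "{..<q} - {a} = (\<Union>x\<in>C. flanked x a)"
    proof (intro equalityI subsetI)
      fix b assume "b \<in> {..<q} - {a}"
      then have "[a, b, a] \<in> U" "b \<noteq> a" using all by auto
      then show "b \<in> (\<Union>x\<in>C. flanked x a)" by (auto simp: flanked_def U_def)
    qed (use fl in blast)
    then have "card ({..<q} - {a}) = (\<Sum>x\<in>C. card (flanked x a))"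
      using finC fl disj finite_subset [OF fl]
      by (simp only:) (intro card_UN_disjoint, simp_all, auto simp: flanked_def disjoint_iff)
    then have "even (q - 1)" using a ev by simp
    then show False using assms(1,2) by simp
  qed
  have "(\<Sum>x\<in>C. card {a. odd (card (flanked x a))}) = (\<Sum>x\<in>C. \<Sum>a<q. of_bool (odd (card (flanked x a))))"
  proof (intro sum.cong refl)
    fix x assume "x \<in> C"
    then have "{a. odd (card (flanked x a))} = {a \<in> {..<q}. odd (card (flanked x a))}"
      using fl' by auto
    then show "card {a. odd (card (flanked x a))} = (\<Sum>a<q. of_bool (odd (card (flanked x a))))"
      by (simp add: sum.inter_filter [symmetric] of_bool_def)
  qed
  also have "\<dots> = (\<Sum>a<q. \<Sum>x\<in>C. of_bool (odd (card (flanked x a))))" by (rule sum.swap)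
  also have "\<dots> = (\<Sum>a<q. card (odds a))"
    using finC by (simp add: odds_def sum.inter_filter [symmetric] of_bool_def)
  finally have "4 * card C + (\<Sum>a<q. card (odds a)) = (\<Sum>x\<in>C. 4 + card {a. odd (card (flanked x a))})"
    by (simp add: sum.distrib)
  also have "\<dots> \<le> (\<Sum>x\<in>C. sum weight (deletions x))"
    using weight_deletions len by (intro sum_mono) auto
  also have "\<dots> = sum weight U"
    unfolding U_def using finC fin disj by (intro sum.UNION_disjoint [symmetric]) auto
  finally have 1: "4 * card C + (\<Sum>a<q. card (odds a)) \<le> sum weight U" .
  \<comment> \<open>The uncovered words \<open>aba\<close>; each has weight at least 1, which is
    lost from the total.\<close>
  define V where "V = (\<lambda>(a, b). [a, b, a]) ` Sigma {..<q} missed"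
  have V: "V \<subseteq> words 3 q" "V \<inter> U = {}" by (auto simp: V_def missed_def words_def)
  have "(\<Sum>a<q. card (missed a)) = card V"
    unfolding V_def by (subst card_image) (auto simp: missed_def intro!: inj_onI)
  also have "\<dots> = (\<Sum>y\<in>V. 1)" by simp
  also have "\<dots> \<le> sum weight V"
    by (intro sum_mono) (auto simp: V_def)
  finally have "sum weight U + (\<Sum>a<q. card (missed a)) \<le> sum weight U + sum weight V" by simp
  also have "\<dots> = sum weight (U \<union> V)"
    using U V finite_words finite_subset by (intro sum.union_disjoint [symmetric]) (blast+)
  also have "\<dots> \<le> sum weight (words 3 q)"
    using U V finite_words by (intro sum_mono2) auto
  finally have 2: "sum weight U + (\<Sum>a<q. card (missed a)) \<le> q ^ 3 + 2 * q\<^sup>2 + q"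
    by (simp only: sum_weight)
  have "(\<Sum>a<q. 1) \<le> (\<Sum>a<q. card (odds a) + card (missed a))"
    using parity by (intro sum_mono) auto
  then have "q \<le> (\<Sum>a<q. card (odds a)) + (\<Sum>a<q. card (missed a))"
    by (simp add: sum.distrib)
  \<comment> \<open>The loss of at least \<open>q\<close> cancels the summand \<open>q\<close> of
    the total weight.\<close>
  with 1 2 show ?thesis by linarith
qed

section \<open>The code and its decoder\<close>

lemma less_13_cases: "i < 13 \<Longrightarrow> i \<in> {0, 1, 2, 3, 4, 5, 6, 7, 8, 9, 10, 11, 12::nat}"
  by (auto simp: numeral_eq_Suc less_Suc_eq)

text \<open>Carries an equation through two decision trees with the same tests, as needed for
  \<open>completion\<close>.\<close>

lemma if_transfer:
  "(P \<Longrightarrow> f x = g x') \<Longrightarrow> (\<not> P \<Longrightarrow> f y = g y') \<Longrightarrow> f (if P then x else y) = g (if P then x' else y')"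
  by simp

text \<open>The interval \<open>{-h..h}\<close> is a full system of residues modulo
  \<open>n\<close>, and \<open>m\<close> generates the subgroup of order 3.\<close>

locale offset_code =
  fixes h m n :: int
  assumes n_odd: "n = 2 * h + 1" and n_triple: "n = 3 * m" and m_pos: "0 < m"
begin

section \<open>Balanced residues and divisibility\<close>

lemma h_less: "2 * h < n" using n_odd by simp

lemma n_pos: "0 < n" using n_triple m_pos by simp

text \<open>The representative of \<open>x\<close> modulo \<open>n\<close> in
  \<open>{-h..h}\<close>, which gives residues a sign and a size.\<close>

definition bal :: "int \<Rightarrow> int" where
  "bal x = (x + h) mod n - h"

lemma bal_eqI:
  assumes "x = u + n * k" "\<bar>u\<bar> \<le> h" shows "bal x = u"
proof -
  have "bal x = (u + h + k * n) mod n - h" using assms(1) by (simp add: bal_def algebra_simps)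
  also have "\<dots> = (u + h) mod n - h" by simp
  also have "(u + h) mod n = u + h" using assms(2) n_odd by (intro mod_pos_pos_trivial) auto
  finally show ?thesis by simp
qed

lemma bal_cong: "x mod n = y mod n \<Longrightarrow> bal x = bal y"
  unfolding bal_def by (metis mod_add_left_eq)

lemma small_not_dvd: "u \<noteq> 0 \<Longrightarrow> \<bar>u\<bar> < n \<Longrightarrow> \<not> n dvd u"
  using dvd_imp_le_int[of u n] n_pos by auto

lemma n_dvd_iff: "-n < x \<Longrightarrow> x < n \<Longrightarrow> n dvd x \<longleftrightarrow> x = 0"
  using small_not_dvd[of x] by (cases "x = 0") auto

lemma dvd_double: "n dvd 2 * u \<longleftrightarrow> n dvd u"
proof -
  have "coprime n 2" using n_odd by simp
  then show ?thesis by (simp add: coprime_dvd_mult_right_iff)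
qed

lemma m_dvd_double: "m dvd 2 * u \<longleftrightarrow> m dvd u"
proof -
  have "odd (3 * m)" using n_odd n_triple by presburger
  then have "odd m" by simp
  then have "coprime m 2" by simp
  then show ?thesis by (simp add: coprime_dvd_mult_right_iff)
qed

text \<open>From \<open>2 * h < n = 3 * m\<close> only the multiples 0, \<open>m\<close> and
  \<open>-m\<close> fit into \<open>{-h..h}\<close>.\<close>

lemma m_dvd_cases:
  assumes "m dvd u" "\<bar>u\<bar> \<le> h" shows "u = 0 \<or> \<bar>u\<bar> = m"
proof -
  obtain k where k: "u = m * k" using assms(1) by (auto elim: dvdE)
  have "2 * \<bar>u\<bar> < 3 * m" using assms(2) n_odd n_triple by linarith
  then have "m * (2 * \<bar>k\<bar>) < m * 3" using k m_pos by (simp add: abs_mult mult.commute)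
  then have "2 * \<bar>k\<bar> < 3" using m_pos by (simp only: mult_less_cancel_left_pos)
  then have "k = 0 \<or> k = 1 \<or> k = -1" by linarith
  then show ?thesis using k m_pos by auto
qed

definition word :: "int \<Rightarrow> (int \<times> bool) list \<Rightarrow> (int \<times> bool) list" where
  "word c T = map (\<lambda>(k, b). ((c + k) mod n, b)) T"

text \<open>The balanced residues outside the subgroup of order 3.\<close>

definition steps :: "int set" where
  "steps = {d. \<bar>d\<bar> \<le> h \<and> d \<noteq> 0 \<and> \<bar>d\<bar> \<noteq> m}"

text \<open>Half-diagonals of a parallelogram with centre 0 and four distinct vertices
  \<open>u\<close>, \<open>-u\<close>, \<open>v\<close>, \<open>-v\<close>. Family 9 uses such pairs
  as sides instead.\<close>

definition pairs :: "(int \<times> int) set" where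
  "pairs = {(u, v). \<bar>u\<bar> \<le> h \<and> \<bar>v\<bar> \<le> h \<and> u \<noteq> 0 \<and> v \<noteq> 0 \<and> \<bar>u\<bar> \<noteq> \<bar>v\<bar>}"

text \<open>
  The codewords are the translates of templates, which list the offsets of the residues and the bits.
  Template families 3 to 6 are degenerate parallelograms \<open>x + x = y + z\<close>; families 7, 8 and 9 are the
  proper ones with bit patterns 0101, 1100 and constant. Families 1 and 2 cover what families 3 to 6
  leave of the words with two distinct residues. Families 10 to 12 form the code on the cosets; they
  were found by computer search. In families 8 and 9 the sign conditions select one of several words
  that share deletions.
\<close>

definition templates :: "nat \<Rightarrow> (int \<times> bool) list set" where
  "templates i =
    [(\<lambda>(d, a, b). [(0, a), (0, a), (d, b), (d, b)]) ` ({-h..h} \<times> UNIV \<times> UNIV),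
     (\<lambda>d. [(0, False), (0, True), (d, False), (d, True)]) ` steps,
     (\<lambda>d. [(0, False), (d, True), (d, False), (0, True)]) ` steps,
     (\<lambda>d. [(0, False), (d, False), (-d, True), (0, False)]) ` steps,
     (\<lambda>d. [(0, True), (d, False), (-d, True), (0, True)]) ` steps,
     (\<lambda>d. [(0, True), (d, False), (0, False), (-d, False)]) ` steps,
     (\<lambda>d. [(d, True), (0, True), (-d, True), (0, False)]) ` steps,
     (\<lambda>(u, v). [(u, False), (-u, True), (v, False), (-v, True)]) ` pairs,
     (\<lambda>(u, v). [(u, True), (-u, True), (v, False), (-v, False)]) ` {(u, v) \<in> pairs. u * v > 0},
     (\<lambda>((s, t), b). [(0, b), (t, b), (s, b), (s + t, b)]) `
        ({(s, t) \<in> pairs. s * t > 0 \<and> \<bar>s\<bar> < \<bar>t\<bar>} \<times> UNIV),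
     (\<lambda>(s, b). [(0, b), (s, b), (s, \<not> b), (-s, b)]) ` ({m, -m} \<times> UNIV),
     (\<lambda>(s, b). [(0, b), (s, b), (-s, \<not> b), (0, \<not> b)]) ` ({m, -m} \<times> UNIV),
     (\<lambda>(s, b). [(0, b), (s, \<not> b), (s, b), (0, b)]) ` ({m, -m} \<times> UNIV)] ! i"

text \<open>
  The decoder. A word of length 3 is described by the differences \<open>d\<close>, \<open>e\<close> of consecutive residues and
  by its bits; the result is the family and the template of its codeword, with offsets relative to the
  first letter. For distinct residues \<open>p, q, r\<close> and mixed bits the missing residue is \<open>p + q - r\<close> if the
  middle bit is 1 and \<open>q + r - p\<close> if it is 0; it coincides with one of the three exactly for
  arithmetic progressions, which lead to families 3 to 6. Multiplication by \<open>h + 1\<close> halves a residue.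
\<close>

definition completion :: "int \<Rightarrow> int \<Rightarrow> bool \<Rightarrow> bool \<Rightarrow> bool \<Rightarrow> nat \<times> (int \<times> bool) list" where
  "completion d e a b c =
    (if n dvd d \<and> a = b \<or> n dvd e \<and> b = c then (0, [(0, a), (0, a), (d + e, c), (d + e, c)])
     else if m dvd d \<and> m dvd e then
       (if n dvd d then
          (if a = c then (10, [(-e, a), (0, a), (0, \<not> a), (e, a)])
           else (12, [(e, \<not> a), (0, a), (0, \<not> a), (e, \<not> a)]))
        else if n dvd e then
          (if a = b then (10, [(0, a), (d, a), (d, \<not> a), (-d, a)])
           else (12, [(0, a), (d, \<not> a), (d, a), (0, a)]))
        else if n dvd d + e then
          (if a = c then (12, [(0, a), (d, \<not> a), (d, a), (0, a)])
           else if a = b then (11, [(0, a), (d, a), (-d, \<not> a), (0, \<not> a)])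
           else (11, [(0, a), (-d, a), (d, \<not> a), (0, \<not> a)]))
        else
          (if a = c then (10, [(0, a), (d, a), (d, \<not> a), (-d, a)])
           else if a = b then (11, [(0, a), (d, a), (-d, \<not> a), (0, \<not> a)])
           else (11, [(-d, a), (0, a), (d, \<not> a), (-d, \<not> a)])))
     else if n dvd d then
       (if \<not> a then (1, [(0, False), (0, True), (e, False), (e, True)])
        else if c then (2, [(e, False), (0, True), (0, False), (e, True)])
        else (5, [(0, True), (-e, False), (0, False), (e, False)]))
     else if n dvd e then
       (if c then (1, [(0, False), (0, True), (d, False), (d, True)])
        else if a then (6, [(0, True), (d, True), (2 * d, True), (d, False)])
        else (2, [(0, False), (d, True), (d, False), (0, True)]))
     else if n dvd d + e then
       (if a = c then
          (if a then
            (if b then (4, [(0, True), (-d, False), (d, True), (0, True)])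
             else (4, [(0, True), (d, False), (-d, True), (0, True)]))
           else
            (if b then (3, [(0, False), (-d, False), (d, True), (0, False)])
             else (3, [(0, False), (d, False), (-d, True), (0, False)])))
        else if c then (2, [(0, False), (d, True), (d, False), (0, True)])
        else if b then (6, [(-d, True), (0, True), (d, True), (0, False)])
        else (5, [(0, True), (d, False), (0, False), (-d, False)]))
     else if a = b \<and> b = c then
       (if n dvd d - e then
          (if a then (6, [(0, a), (d, a), (d + e, a), (d, False)])
           else (5, [(d, True), (0, a), (d, a), (d + e, a)]))
        else if bal d * bal e > 0 then
            (if \<bar>bal d\<bar> > \<bar>bal e\<bar> then (9, [(0, a), (d, a), (e, a), (d + e, a)])
             else (9, [(0, a), (e, a), (d, a), (d + e, a)]))
          else
            (if \<bar>bal d\<bar> > \<bar>bal e\<bar> then (9, [(0, a), (d, a), (d + e, a), (2 * d + e, a)])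
             else (9, [(-e, a), (0, a), (d, a), (d + e, a)])))
     else if b then
       (if n dvd d + 2 * e then
          (if c then (4, [(d + e, True), (0, False), (d, True), (d + e, True)])
           else if a then (6, [(0, True), (d + e, True), (d, True), (d + e, False)])
           else (3, [(d + e, False), (0, False), (d, True), (d + e, False)]))
        else
          (if c then (7, [(0, False), (d, True), (-e, False), (d + e, True)])
           else if a then
            (if bal (- d * (h + 1)) * bal (d + e - d * (h + 1)) > 0
             then (8, [(0, True), (d, True), (d + e, False), (-e, False)])
             else (8, [(0, True), (d, True), (-e, False), (d + e, False)]))
           else (7, [(0, False), (d, True), (d + e, False), (-e, True)])))
     else
       (if n dvd 2 * d + e then
          (if c then
             (if a then (4, [(0, True), (d, False), (d + e, True), (0, True)])
              else (3, [(0, False), (d, False), (d + e, True), (0, False)]))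
           else (5, [(0, True), (d, False), (0, False), (d + e, False)]))
        else
          (if c then
             (if a then (7, [(2 * d + e, False), (0, True), (d, False), (d + e, True)])
              else (7, [(0, False), (2 * d + e, True), (d, False), (d + e, True)]))
           else if bal (- (2 * d + e) * (h + 1)) * bal (- e * (h + 1)) > 0
             then (8, [(0, True), (2 * d + e, True), (d, False), (d + e, False)])
             else (8, [(2 * d + e, True), (0, True), (d, False), (d + e, False)]))))"

fun dec :: "(int \<times> bool) list \<Rightarrow> nat \<times> (int \<times> bool) list" where
  "dec [(p, a), (q, b), (r, c)] = map_prod id (word p) (completion (q - p) (r - q) a b c)"
| "dec _ = undefined"

section \<open>Independence of the decoder from representatives\<close>

lemma m_dvd_mod: "m dvd x mod n \<longleftrightarrow> m dvd x"
  using n_triple by (simp add: dvd_mod_iff)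

lemma bal_mod: "bal (x mod n) = bal x"
  unfolding bal_def by (simp add: mod_simps)

text \<open>All tests depend only on residues modulo \<open>n\<close>, because \<open>m\<close>
  divides \<open>n\<close> and \<open>bal\<close> is periodic; all offsets are integer combinations
  of \<open>d\<close> and \<open>e\<close>.\<close>

lemma completion_mod:
  "map_prod id (word (p mod n)) (completion (d mod n) (e mod n) a b c)
    = map_prod id (word p) (completion d e a b c)"
proof -
  have t: "n dvd d mod n \<longleftrightarrow> n dvd d" "n dvd e mod n \<longleftrightarrow> n dvd e"
    "n dvd d mod n + e mod n \<longleftrightarrow> n dvd d + e" "n dvd d mod n - e mod n \<longleftrightarrow> n dvd d - e"
    by (simp_all add: dvd_eq_mod_eq_0 mod_simps)
  have t2: "n dvd d mod n + 2 * (e mod n) \<longleftrightarrow> n dvd d + 2 * e"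
    "n dvd 2 * (d mod n) + e mod n \<longleftrightarrow> n dvd 2 * d + e"
    by (simp_all only: dvd_eq_mod_eq_0
        mod_add_cong [OF mod_mod_trivial mod_mult_cong [OF refl mod_mod_trivial]]
        mod_add_cong [OF mod_mult_cong [OF refl mod_mod_trivial] mod_mod_trivial])
  have b: "bal (- (d mod n) * (h + 1)) = bal (- d * (h + 1))"
    "bal (d mod n + e mod n - d mod n * (h + 1)) = bal (d + e - d * (h + 1))"
    "bal (- (2 * (d mod n) + e mod n) * (h + 1)) = bal (- (2 * d + e) * (h + 1))"
    "bal (- (e mod n) * (h + 1)) = bal (- e * (h + 1))"
    by (rule bal_cong, intro mod_add_cong mod_diff_cong mod_minus_cong mod_mult_cong; simp)+
  have w: "(p + x mod n) mod n = (p + x) mod n" "(p + - (x mod n)) mod n = (p + - x) mod n"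
    "(p + 2 * (x mod n)) mod n = (p + 2 * x) mod n"
    "(p + (x mod n + y mod n)) mod n = (p + (x + y)) mod n"
    "(p + (2 * (x mod n) + y mod n)) mod n = (p + (2 * x + y)) mod n" for x y
    by (intro mod_add_cong mod_minus_cong mod_mult_cong; simp)+
  show ?thesis
    unfolding completion_def t t2 b bal_mod m_dvd_mod
    by (intro if_transfer [of _ "map_prod id (word (p mod n))" _ "map_prod id (word p)"];
        simp only: map_prod_simp word_def list.map id_apply prod.case w mod_add_left_eq)
qed

text \<open>Decoding can thus be computed with the unreduced offsets of a template.\<close>

lemma dec_word:
  "dec (word c [(x, a), (y, b), (z, e)]) = map_prod id (word (c + x)) (completion (y - x) (z - y) a b e)"
proof -
  have "dec (word c [(x, a), (y, b), (z, e)])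
    = map_prod id (word ((c + x) mod n))
        (completion ((c + y) mod n - (c + x) mod n) ((c + z) mod n - (c + y) mod n) a b e)"
    by (simp add: word_def)
  also have "\<dots> = map_prod id (word (c + x)) (completion (y - x) (z - y) a b e)"
    by (subst (1 2) completion_mod [symmetric]) (simp add: mod_simps)
  finally show ?thesis .
qed

lemma word_shift: "word (c + x) T = word c (map (\<lambda>(k, b). (x + k, b)) T)"
  by (simp add: word_def case_prod_beta add.assoc)

lemma word_shift_minus: "word (c - x) T = word c (map (\<lambda>(k, b). (k - x, b)) T)"
  by (simp add: word_def case_prod_beta algebra_simps)

section \<open>Decoding of each template family\<close>

lemma steps_facts:
  assumes "d \<in> steps"
  shows "\<not> m dvd d" "\<not> n dvd d" "\<not> n dvd 2 * d" "d \<noteq> 0" "d \<le> h" "- h \<le> d"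
proof -
  show "\<not> m dvd d" using m_dvd_cases[of d] assms by (auto simp: steps_def)
  then show "\<not> n dvd d" using n_triple by (auto dest: dvd_trans[of m n d])
  then show "\<not> n dvd 2 * d" by (simp add: dvd_double)
qed (use assms in \<open>auto simp: steps_def\<close>)

text \<open>As \<open>d\<close> is outside the subgroup of order 3, the coset branch is avoided.
  Three distinct residues, where they occur, are \<open>-d\<close>, \<open>0\<close>,
  \<open>d\<close>, an arithmetic progression.\<close>

lemma dec_steps:
  assumes "d \<in> steps"
  shows "y \<in> deletions [(0, False), (0, True), (d, False), (d, True)] \<Longrightarrow>
      dec (word c y) = (1, word c [(0, False), (0, True), (d, False), (d, True)])"
    "y \<in> deletions [(0, False), (d, True), (d, False), (0, True)] \<Longrightarrow>
      dec (word c y) = (2, word c [(0, False), (d, True), (d, False), (0, True)])"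
    "y \<in> deletions [(0, False), (d, False), (-d, True), (0, False)] \<Longrightarrow>
      dec (word c y) = (3, word c [(0, False), (d, False), (-d, True), (0, False)])"
    "y \<in> deletions [(0, True), (d, False), (-d, True), (0, True)] \<Longrightarrow>
      dec (word c y) = (4, word c [(0, True), (d, False), (-d, True), (0, True)])"
    "y \<in> deletions [(0, True), (d, False), (0, False), (-d, False)] \<Longrightarrow>
      dec (word c y) = (5, word c [(0, True), (d, False), (0, False), (-d, False)])"
    "y \<in> deletions [(d, True), (0, True), (-d, True), (0, False)] \<Longrightarrow>
      dec (word c y) = (6, word c [(d, True), (0, True), (-d, True), (0, False)])"
  using steps_facts[OF assms] h_less
  by (auto simp: dec_word word_shift completion_def n_dvd_iff simp del: dec.simps)

text \<open>These decide the tests met in decoding families 7 and 8. The last four say that no three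
  vertices lie in one coset of the subgroup of order 3.\<close>

lemma pairs_facts:
  assumes "(u, v) \<in> pairs"
  shows "\<not> n dvd u" "\<not> n dvd v" "\<not> n dvd v + u" "\<not> n dvd u - v" "\<not> n dvd v - u"
    "\<not> n dvd - v - u" "\<not> n dvd - u - v"
    "\<not> (m dvd u \<and> m dvd u - v)" "\<not> (m dvd u \<and> m dvd v + u)"
    "\<not> (m dvd v + u \<and> m dvd v)" "\<not> (m dvd v - u \<and> m dvd v)"
proof -
  have f: "u \<noteq> 0" "v \<noteq> 0" "u \<noteq> v" "u + v \<noteq> 0" "u \<le> h" "-h \<le> u" "v \<le> h" "-h \<le> v"
    using assms by (auto simp: pairs_def)
  then show "\<not> n dvd u" "\<not> n dvd v" "\<not> n dvd v + u" "\<not> n dvd u - v" "\<not> n dvd v - u"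
    "\<not> n dvd - v - u" "\<not> n dvd - u - v"
    using h_less by (simp_all add: n_dvd_iff)
  have "\<not> (m dvd u \<and> m dvd v)"
    using m_dvd_cases[of u] m_dvd_cases[of v] assms by (auto simp: pairs_def)
  moreover have "m dvd v" if "m dvd u" "m dvd u - v" using dvd_diff[OF that] by simp
  moreover have "m dvd v" if "m dvd v + u" "m dvd u" using dvd_diff[OF that] by simp
  moreover have "m dvd u" if "m dvd v + u" "m dvd v" using dvd_diff[OF that] by simp
  moreover have "m dvd u" if "m dvd v" "m dvd v - u" using dvd_diff[OF that] by simp
  ultimately show "\<not> (m dvd u \<and> m dvd u - v)" "\<not> (m dvd u \<and> m dvd v + u)"
    "\<not> (m dvd v + u \<and> m dvd v)" "\<not> (m dvd v - u \<and> m dvd v)"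
    by blast+
qed

lemma dec_pairs:
  assumes "(u, v) \<in> pairs" "y \<in> deletions [(u, False), (-u, True), (v, False), (-v, True)]"
  shows "dec (word c y) = (7, word c [(u, False), (-u, True), (v, False), (-v, True)])"
  using assms(2)
  by (cases rule: deletions_cases)
    (simp_all add: pairs_facts[OF assms(1)] dec_word word_shift word_shift_minus completion_def
      m_dvd_double dvd_double del: dec.simps)

lemma dec_same_sign_pairs:
  assumes uv: "(u, v) \<in> pairs" and pos: "u * v > 0"
    and y: "y \<in> deletions [(u, True), (-u, True), (v, False), (-v, False)]"
  shows "dec (word c y) = (8, word c [(u, True), (-u, True), (v, False), (-v, False)])"
proof -
  have n: "n = 2 * h + 1" by (rule n_odd)
  have bound: "\<bar>u\<bar> \<le> h" "\<bar>-u\<bar> \<le> h" "\<bar>v\<bar> \<le> h" "\<bar>-v\<bar> \<le> h"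
    using uv by (auto simp: pairs_def)
  \<comment> \<open>Since \<open>2 * (h + 1) = n + 1\<close>, the arguments of \<open>bal\<close>
    recover signed half-diagonals. The sign of their product tells which of two neighbouring letters
    with equal bits is missing.\<close>
  have "bal (- (-u-u) * (h + 1)) = u"
    "bal ((-u-u) + (v - (-u)) - (-u-u) * (h + 1)) = v"
    "bal ((-u-u) + ((-v) - (-u)) - (-u-u) * (h + 1)) = - v"
    "bal (- (2 * (v - u) + (-v - v)) * (h + 1)) = u"
    by (rule bal_eqI [of _ _ u]; use bound in \<open>simp add: n algebra_simps\<close>)+
  moreover have "bal (- (2 * (v - (-u)) + (-v - v)) * (h + 1)) = - u"
    by (rule bal_eqI [of _ _ "-u"]; use bound in \<open>simp add: n algebra_simps\<close>)
  moreover have "bal (- (-v - v) * (h + 1)) = v"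
    by (rule bal_eqI [of _ _ v]; use bound in \<open>simp add: n algebra_simps\<close>)
  moreover have "\<not> u * v < 0" using pos by simp
  moreover note y
  ultimately show ?thesis
    by - (erule deletions_cases; simp add: pairs_facts[OF uv] pos dec_word word_shift word_shift_minus
        completion_def m_dvd_double dvd_double del: dec.simps)
qed

lemma dec_letters:
  assumes "y \<in> deletions [(0, a), (0, a), (d, b), (d, b)]"
  shows "dec (word c y) = (0, word c [(0, a), (0, a), (d, b), (d, b)])"
  using assms
  by (cases rule: deletions_cases)
    (simp_all add: dec_word word_shift completion_def del: dec.simps)

lemma m_facts:
  assumes "s = m \<or> s = - m"
  shows "m dvd s" "\<not> n dvd s" "\<not> n dvd 2 * s" "n dvd 3 * s"
  using assms n_triple m_pos by (auto simp: dvd_double n_dvd_iff)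

lemma dec_cosets:
  assumes s: "s = m \<or> s = - m"
  shows "y \<in> deletions [(0, b), (s, b), (s, \<not> b), (-s, b)] \<Longrightarrow>
      dec (word c y) = (10, word c [(0, b), (s, b), (s, \<not> b), (-s, b)])"
    "y \<in> deletions [(0, b), (s, b), (-s, \<not> b), (0, \<not> b)] \<Longrightarrow>
      dec (word c y) = (11, word c [(0, b), (s, b), (-s, \<not> b), (0, \<not> b)])"
    "y \<in> deletions [(0, b), (s, \<not> b), (s, b), (0, b)] \<Longrightarrow>
      dec (word c y) = (12, word c [(0, b), (s, \<not> b), (s, b), (0, b)])"
proof -
  \<comment> \<open>As \<open>n\<close> divides \<open>3 * s\<close>, the offsets
    \<open>2 * s\<close> and \<open>-s\<close> agree modulo \<open>n\<close>; this identifies the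
    decoder's offsets with those of the template.\<close>
  have "(k + 3 * s) mod n = k mod n" for k
    using m_facts(4)[OF s] by (simp add: mod_eq_dvd_iff)
  from this this[of "k - 2 * s" for k] this[of "k - s" for k] this[of "k - 3 * s" for k]
  have "(k + 3 * s) mod n = k mod n" "(k - 2 * s) mod n = (k + s) mod n"
    "(k + 2 * s) mod n = (k - s) mod n" "(k - 3 * s) mod n = k mod n"
    "(k + s * 3) mod n = k mod n" "(k - s * 2) mod n = (k + s) mod n"
    "(k + s * 2) mod n = (k - s) mod n" "(k - s * 3) mod n = k mod n" for k
    by (simp_all add: algebra_simps)
  note f = this m_facts[OF s] dec_word completion_def dvd_double
  show "y \<in> deletions [(0, b), (s, b), (s, \<not> b), (-s, b)] \<Longrightarrow>
      dec (word c y) = (10, word c [(0, b), (s, b), (s, \<not> b), (-s, b)])"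
    "y \<in> deletions [(0, b), (s, b), (-s, \<not> b), (0, \<not> b)] \<Longrightarrow>
      dec (word c y) = (11, word c [(0, b), (s, b), (-s, \<not> b), (0, \<not> b)])"
    "y \<in> deletions [(0, b), (s, \<not> b), (s, b), (0, b)] \<Longrightarrow>
      dec (word c y) = (12, word c [(0, b), (s, \<not> b), (s, b), (0, b)])"
    by (erule deletions_cases; simp add: f del: dec.simps; simp add: f word_def algebra_simps)+
qed

text \<open>Equal signs and the size condition keep \<open>s - t\<close> balanced and
  \<open>s + t\<close>, \<open>2 * t - s\<close> nonzero modulo \<open>n\<close>. The missing letter
  then shows in the signs and relative size of the two differences.\<close>

lemma dec_constant_bit:
  assumes st: "(s, t) \<in> pairs" and pos: "s * t > 0" and less: "\<bar>s\<bar> < \<bar>t\<bar>"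
    and y: "y \<in> deletions [(0, b), (t, b), (s, b), (s + t, b)]"
  shows "dec (word c y) = (9, word c [(0, b), (t, b), (s, b), (s + t, b)])"
proof -
  have b: "bal t = t" "bal s = s" "bal (s - t) = s - t"
     using st pos less by (auto intro!: bal_eqI[of _ _ 0] simp: pairs_def zero_less_mult_iff)
  have p: "\<not> 0 < (s - t) * t" "\<not> 0 < t * (s - t)" "0 < t * s"
    using pos less by (auto simp: zero_less_mult_iff)
  have q: "\<not> \<bar>t\<bar> < \<bar>s\<bar>" "\<bar>s - t\<bar> < \<bar>t\<bar>" "\<not> \<bar>t\<bar> < \<bar>s - t\<bar>"
    using pos less by (auto simp: zero_less_mult_iff)
  have nd: "\<not> n dvd s" "\<not> n dvd t" "\<not> n dvd s - t" "\<not> n dvd t - s" "\<not> n dvd s + t" "\<not> n dvd t + s"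
     "\<not> n dvd 2 * t - s" "\<not> n dvd s - 2 * t"
    using st pos less h_less by (auto simp: pairs_def zero_less_mult_iff n_dvd_iff)
  have "\<not> (m dvd s \<and> m dvd t)"
    using m_dvd_cases[of s] m_dvd_cases[of t] st by (auto simp: pairs_def)
  moreover have "m dvd s" if "m dvd t" "m dvd s - t" using dvd_add[OF that] by simp
  ultimately have md: "\<not> (m dvd s \<and> m dvd t)" "\<not> (m dvd t \<and> m dvd s)"
    "\<not> (m dvd t \<and> m dvd s - t)" "\<not> (m dvd s - t \<and> m dvd t)" by blast+
  note f = b p q nd md
  from y show ?thesis
    by (cases rule: deletions_cases)
      (simp_all add: f pos less add.commute[of t s] dec_word word_shift word_shift_minus
        completion_def del: dec.simps)
qed

lemma m_le_h: "m \<le> h"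
  using n_odd n_triple m_pos by linarith

text \<open>Returning the family along with the codeword yields both the correction of deletions and
  the disjointness of the families.\<close>

lemma dec_templates:
  assumes "i < 13" "T \<in> templates i" "y \<in> deletions (word c T)"
  shows "dec y = (i, word c T)"
proof -
  obtain z where z: "y = word c z" "z \<in> deletions T"
    using assms(3) by (auto simp: word_def deletions_map)
  have "i \<in> {0, 1, 2, 3, 4, 5, 6, 7, 8, 9, 10, 11, 12}" using assms(1) by (rule less_13_cases)
  then show ?thesis using assms(2) z(2) unfolding z(1)
    by (elim insertE emptyE;
      clarsimp simp: templates_def dec_letters dec_steps dec_pairs dec_same_sign_pairs
        dec_constant_bit dec_cosets simp del: dec.simps deletions.simps)
qed

section \<open>Size of the code\<close>

lemma card_steps: "int (card steps) = 2 * h - 2"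
proof -
  have "steps = {-h..h} - {0, m, -m}" using m_pos by (auto simp: steps_def)
  then have "card steps = card {-h..h} - card {0, m, -m}"
    using m_le_h m_pos by (simp only:) (intro card_Diff_subset, auto)
  moreover have "card {0, m, -m} = 3" using m_pos by simp
  ultimately show ?thesis using m_le_h m_pos by simp
qed

lemma finite_steps: "finite steps"
  by (rule finite_subset [of _ "{-h..h}"]) (auto simp: steps_def)

lemma finite_pairs: "finite pairs"
  by (rule finite_subset[of _ "{-h..h} \<times> {-h..h}"]) (auto simp: pairs_def)

lemma card_pairs: "int (card pairs) = 2 * h * (2 * h - 2)"
proof -
  have "pairs = Sigma ({-h..h} - {0}) (\<lambda>u. {-h..h} - {0, u, -u})"
    by (auto simp: pairs_def)
  moreover have "card ({-h..h} - {0, u, -u}) = nat (2 * h - 2)" if "u \<in> {-h..h} - {0}" for u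
  proof -
    have "card ({-h..h} - {0, u, -u}) = card {-h..h} - card {0, u, -u}"
      using that by (intro card_Diff_subset) auto
    moreover have "card {0, u, -u} = 3" using that by auto
    ultimately show ?thesis by simp
  qed
  ultimately have "card pairs = card ({-h..h} - {0}) * nat (2 * h - 2)" by simp
  then show ?thesis using m_le_h m_pos by simp
qed

text \<open>Negating \<open>v\<close> exchanges the two signs of \<open>u * v\<close>, so this is
  half of \<open>pairs\<close>.\<close>

lemma card_same_sign: "int (card {(u, v) \<in> pairs. u * v > 0}) = 2 * h * (h - 1)"
proof -
  have "bij_betw (\<lambda>(u, v). (u, -v)) {(u, v) \<in> pairs. u * v > 0} {(u, v) \<in> pairs. u * v < 0}"
    by (rule bij_betw_byWitness [of _ "\<lambda>(u, v). (u, -v)"]) (auto simp: pairs_def)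
  then have "card {(u, v) \<in> pairs. u * v < 0} = card {(u, v) \<in> pairs. u * v > 0}"
    by (rule bij_betw_same_card [symmetric])
  moreover have "pairs = {(u, v) \<in> pairs. u * v > 0} \<union> {(u, v) \<in> pairs. u * v < 0}"
    by (auto simp: pairs_def zero_less_mult_iff mult_less_0_iff)
  then have "card pairs = card {(u, v) \<in> pairs. u * v > 0} + card {(u, v) \<in> pairs. u * v < 0}"
    by (subst card_Un_disjoint [symmetric]) (auto intro: finite_subset [OF _ finite_pairs])
  ultimately show ?thesis using card_pairs by (simp add: algebra_simps)
qed

text \<open>Swapping the entries halves the count once more.\<close>

lemma card_increasing:
  "int (card {(s, t) \<in> pairs. s * t > 0 \<and> \<bar>s\<bar> < \<bar>t\<bar>}) = h * (h - 1)"
proof -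
  let ?A = "{(s, t) \<in> pairs. s * t > 0 \<and> \<bar>s\<bar> < \<bar>t\<bar>}" and ?B = "{(s, t) \<in> pairs. s * t > 0 \<and> \<bar>t\<bar> < \<bar>s\<bar>}"
  have "bij_betw prod.swap ?A ?B"
    by (rule bij_betw_byWitness [of _ prod.swap]) (auto simp: pairs_def mult.commute)
  then have "card ?B = card ?A"
    by (rule bij_betw_same_card [symmetric])
  moreover have "{(u, v) \<in> pairs. u * v > 0} = ?A \<union> ?B"
    by (auto simp: pairs_def)
  then have "card {(u, v) \<in> pairs. u * v > 0} = card ?A + card ?B"
    by (subst card_Un_disjoint [symmetric]) (auto intro: finite_subset [OF _ finite_pairs])
  ultimately show ?thesis using card_same_sign by (simp add: algebra_simps)
qed

lemma residue_eq_iff: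
  "\<bar>x\<bar> \<le> h \<Longrightarrow> \<bar>y\<bar> \<le> h \<Longrightarrow> (c + x) mod n = (c + y) mod n \<longleftrightarrow> x = y"
  using h_less by (auto simp: mod_eq_dvd_iff n_dvd_iff)

text \<open>In families 7 and 8 no letter has offset 0; there \<open>c\<close> is recovered as the
  centre of two opposite vertices, by halving modulo the odd number \<open>n\<close>.\<close>

lemma word_inject_pair:
  assumes "(c + u) mod n = (c' + u') mod n" "(c - u) mod n = (c' - u') mod n"
    "c \<in> {0..<n}" "c' \<in> {0..<n}"
  shows "c = c'"
proof -
  have "n dvd (c + u - (c' + u')) + (c - u - (c' - u'))"
    using assms(1,2) by (intro dvd_add) (simp_all add: mod_eq_dvd_iff)
  then have "n dvd 2 * (c - c')" by (simp add: algebra_simps)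
  then have "c mod n = c' mod n" by (simp only: dvd_double mod_eq_dvd_iff)
  then show ?thesis using assms(3,4) by simp
qed

lemma offset_bounds: "\<bar>0\<bar> \<le> h" "\<bar>m\<bar> \<le> h" "\<bar>-m\<bar> \<le> h"
  using m_le_h m_pos by auto

lemma antipodal_residues: "(c + m) mod n \<noteq> (c - m) mod n" "(c - m) mod n \<noteq> (c + m) mod n"
  using residue_eq_iff [of m "-m" c] offset_bounds m_pos by auto

lemma steps_bound: "d \<in> steps \<Longrightarrow> \<bar>d\<bar> \<le> h"
  by (simp add: steps_def)

lemma pairs_bound: "(u, v) \<in> pairs \<Longrightarrow> \<bar>u\<bar> \<le> h \<and> \<bar>v\<bar> \<le> h"
  by (simp add: pairs_def)

lemma inj_on_word:
  assumes "i < 13"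
  shows "inj_on (\<lambda>(c, T). word c T) ({0..<n} \<times> templates i)"
proof -
  \<comment> \<open>In the other families a fixed position has offset 0 and shows
    \<open>c\<close>.\<close>
  have *: "c = c'" if "i < 13" "T \<in> templates i" "T' \<in> templates i" "word c T = word c' T'"
    "c \<in> {0..<n}" "c' \<in> {0..<n}" for c c' T T'
    using less_13_cases [OF that(1)] that(2-)
    by (elim insertE emptyE; clarsimp simp: templates_def word_def simp del: atLeastLessThan_iff)
      (auto intro: word_inject_pair)
  \<comment> \<open>For given \<open>c\<close>, the parameters of a template are balanced offsets,
    hence determined by their residues.\<close>
  have **: "T = T'" if "i < 13" "T \<in> templates i" "T' \<in> templates i" "word c T = word c T'" for c T T'
    using less_13_cases [OF that(1)] that(2-)
    by (elim insertE emptyE; clarsimp simp: templates_def word_def;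
      auto simp: residue_eq_iff offset_bounds antipodal_residues dest!: steps_bound pairs_bound)
  show ?thesis
  proof (rule inj_onI, clarify)
    fix c T c' T'
    assume "c \<in> {0..<n}" "c' \<in> {0..<n}" and T: "T \<in> templates i" "T' \<in> templates i"
      and eq: "word c T = word c' T'"
    then have "c = c'" using * [OF assms] by blast
    then show "c = c' \<and> T = T'" using ** [OF assms T] eq by simp
  qed
qed

definition code_part :: "nat \<Rightarrow> (int \<times> bool) list set" where
  "code_part i = (\<lambda>(c, T). word c T) ` ({0..<n} \<times> templates i)"

lemma finite_code_part: "i < 13 \<Longrightarrow> finite (code_part i)"
  unfolding code_part_def
  by (drule less_13_cases, elim insertE emptyE; simp add: templates_def finite_steps finite_pairs;
    intro finite_imageI finite_cartesian_product finite_subset [OF _ finite_pairs]) auto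

lemma card_templates:
  "int (card (templates 0)) = 4 * (2 * h + 1)"
  "i \<in> {1, 2, 3, 4, 5, 6} \<Longrightarrow> int (card (templates i)) = 2 * h - 2"
  "int (card (templates 7)) = 2 * h * (2 * h - 2)"
  "int (card (templates 8)) = 2 * h * (h - 1)"
  "int (card (templates 9)) = 2 * h * (h - 1)"
  "i \<in> {10, 11, 12} \<Longrightarrow> int (card (templates i)) = 4"
proof -
  have h: "0 \<le> h" using m_le_h m_pos by simp
  show "int (card (templates 0)) = 4 * (2 * h + 1)"
    unfolding templates_def using h
    by (subst nth_Cons_0, subst card_image)
      (auto simp: card_cartesian_product card_UNIV_bool intro!: inj_onI simp flip: UNIV_Times_UNIV)
  show "i \<in> {1, 2, 3, 4, 5, 6} \<Longrightarrow> int (card (templates i)) = 2 * h - 2"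
    by (elim insertE emptyE; simp add: templates_def; subst card_image; auto simp: card_steps intro!: inj_onI)
  show "int (card (templates 7)) = 2 * h * (2 * h - 2)"
    unfolding templates_def by (simp, subst card_image) (auto simp: card_pairs intro!: inj_onI)
  show "int (card (templates 8)) = 2 * h * (h - 1)"
    unfolding templates_def by (simp, subst card_image) (auto simp: card_same_sign intro!: inj_onI)
  show "int (card (templates 9)) = 2 * h * (h - 1)"
    unfolding templates_def
    by (simp, subst card_image) (auto simp: card_increasing card_cartesian_product intro!: inj_onI)
  show "i \<in> {10, 11, 12} \<Longrightarrow> int (card (templates i)) = 4"
    using m_pos
    by (elim insertE emptyE; simp add: templates_def; subst card_image;
      auto simp: card_cartesian_product intro!: inj_onI)
qed

lemma card_code_part: "i < 13 \<Longrightarrow> int (card (code_part i)) = n * int (card (templates i))"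
  unfolding code_part_def using n_pos
  by (subst card_image [OF inj_on_word]) (simp_all add: card_cartesian_product)

lemma length_code_part:
  assumes "i < 13" "w \<in> code_part i" shows "length w = 4"
  using less_13_cases [OF assms(1)] assms(2)
  by (elim insertE emptyE) (auto simp: code_part_def templates_def word_def)

text \<open>Any deletion of \<open>w\<close> would be decoded to both families.\<close>

lemma code_part_disjoint:
  assumes "i < 13" "j < 13" "w \<in> code_part i" "w \<in> code_part j"
  shows "i = j"
proof -
  have "length w = 4" using assms(1,3) by (rule length_code_part)
  then have "deletions w \<noteq> {}" by (auto simp: length_Suc_conv numeral_eq_Suc)
  then obtain y where y: "y \<in> deletions w" by blast
  have "dec y = (i, w)" "dec y = (j, w)"
    using assms(3,4) y dec_templates [OF assms(1)] dec_templates [OF assms(2)] by (auto simp: code_part_def)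
  then show ?thesis by simp
qed

definition code :: "(int \<times> bool) list set" where
  "code = (\<Union>i<13. code_part i)"

text \<open>For \<open>q = 2 * n\<close> this number is a quarter of \<open>q * q * (q + 2)\<close>,
  meeting the upper bound.\<close>

lemma card_code: "int (card code) = 2 * n\<^sup>2 * (n + 1)"
proof -
  have "card code = (\<Sum>i<13. card (code_part i))"
    unfolding code_def by (intro card_UN_disjoint) (auto simp: finite_code_part dest: code_part_disjoint)
  then have "int (card code) = n * (\<Sum>i<13. int (card (templates i)))"
    by (simp add: card_code_part sum_distrib_left)
  \<comment> \<open>The contributions add up to \<open>4 * (2 * h + 1) * (h + 1)\<close>.\<close>
  also have "(\<Sum>i<13. int (card (templates i))) = 2 * n * (n + 1)"
    by (simp add: card_templates lessThan_nat_numeral lessThan_Suc n_odd algebra_simps)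
  finally show ?thesis by (simp add: power2_eq_square)
qed

lemma code_part_letters:
  assumes "i < 13" "w \<in> code_part i" shows "set w \<subseteq> {0..<n} \<times> UNIV"
  using less_13_cases [OF assms(1)] assms(2) n_pos
  by (elim insertE emptyE) (auto simp: code_part_def templates_def word_def)

section \<open>Transfer to natural numbers as letters\<close>

definition encode :: "int \<times> bool \<Rightarrow> nat" where
  "encode = (\<lambda>(z, b). 2 * nat z + of_bool b)"

definition decode :: "nat \<Rightarrow> int \<times> bool" where
  "decode l = (int (l div 2), odd l)"

lemma decode_encode: "0 \<le> z \<Longrightarrow> decode (encode (z, b)) = (z, b)"
  by (simp add: decode_def encode_def)

lemma map_decode_encode:
  assumes "w \<in> code" shows "map decode (map encode w) = w"
proof -
  have "decode (encode l) = l" if "l \<in> set w" for l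
    using assms that code_part_letters by (cases l) (fastforce simp: code_def decode_encode)
  then show ?thesis by (simp add: map_idI)
qed

lemma encoded_code:
  "map encode ` code \<subseteq> words 4 (2 * nat n)"
  "del_correcting 1 (map encode ` code)"
  "int (card (map encode ` code)) = 2 * n\<^sup>2 * (n + 1)"
proof -
  have "encode l < 2 * nat n" if "w \<in> code" "l \<in> set w" for l w
  proof -
    have "fst l < n" "0 \<le> fst l" using that code_part_letters by (fastforce simp: code_def)+
    then show ?thesis by (auto simp: encode_def split_beta of_bool_def)
  qed
  then show "map encode ` code \<subseteq> words 4 (2 * nat n)"
    unfolding words_def by (force simp: code_def length_code_part)
  have "w = w'" if w: "w \<in> code" "w' \<in> code"
    and y: "y \<in> del_ball (map encode w) 1" "y \<in> del_ball (map encode w') 1" for w w' y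
  proof -
    \<comment> \<open>Decoding the letters of \<open>y\<close> gives a deletion of \<open>v\<close>,
      from which \<open>dec\<close> returns \<open>v\<close>; applied to \<open>w\<close> and
      \<open>w'\<close>, this forces them to be equal.\<close>
    have "\<exists>i. dec (map decode y) = (i, v)" if v: "v \<in> code" "y \<in> del_ball (map encode v) 1" for v
    proof -
      obtain i where i: "i < 13" "v \<in> code_part i" using v(1) by (auto simp: code_def)
      have "subseq (map decode y) v"
        using v subseq_map [of y "map encode v" decode] map_decode_encode by (simp add: del_ball_def)
      then have "map decode y \<in> deletions v"
        using v(2) length_code_part [OF i] by (intro deletionsI) (auto simp: del_ball_def)
      then show ?thesis using i dec_templates [OF i(1)] by (auto simp: code_part_def)
    qed
    from this [OF w(1) y(1)] this [OF w(2) y(2)] show ?thesis by auto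
  qed
  then show "del_correcting 1 (map encode ` code)"
    unfolding del_correcting_def by blast
  have "inj_on (map encode) code"
    by (rule inj_on_inverseI [of _ "map decode"]) (rule map_decode_encode)
  then show "int (card (map encode ` code)) = 2 * n\<^sup>2 * (n + 1)"
    by (simp add: card_image card_code)
qed

end

theorem theorem4p1:
  fixes m q :: nat
  assumes "m > 0" and "odd m" and "q = 6 * m"
  shows "N 4 q 1 = q^2 * (q + 2) div 4"
proof -
  \<comment> \<open>The number \<open>3 * m\<close> is odd, and \<open>k\<close> takes the role of
    \<open>h\<close>.\<close>
  obtain k where k: "3 * m = 2 * k + 1"
    using assms(2) by (metis even_mult_iff odd_numeral oddE)
  interpret offset_code "int k" "int m" "int (3 * m)"
    using assms(1) k by unfold_locales auto
  define C where "C = map encode ` code"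
  have "nat (int (3 * m)) = 3 * m" by (rule nat_int)
  then have C: "C \<subseteq> words 4 q" "del_correcting 1 C"
    using encoded_code(1,2) assms(3) by (simp_all add: C_def)
  have "int (4 * card C) = int (q\<^sup>2 * (q + 2))"
    using encoded_code(3) assms(3) by (simp add: C_def power2_eq_square algebra_simps)
  then have card_C: "4 * card C = q\<^sup>2 * (q + 2)" by (simp only: of_nat_eq_iff)
  have "Max {card D | D. D \<subseteq> words 4 q \<and> del_correcting 1 D} = card C"
  proof (rule Max_eqI)
    show "finite {card D | D. D \<subseteq> words 4 q \<and> del_correcting 1 D}"
      using finite_words by (simp add: setcompr_eq_image)
    show "card C \<in> {card D | D. D \<subseteq> words 4 q \<and> del_correcting 1 D}"
      using C by blast
    fix k assume "k \<in> {card D | D. D \<subseteq> words 4 q \<and> del_correcting 1 D}"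
    then obtain D where D: "k = card D" "D \<subseteq> words 4 q" "del_correcting 1 D" by blast
    have "4 * card D \<le> q ^ 3 + 2 * q\<^sup>2"
      using D assms by (intro code_upper_bound) auto
    also have "\<dots> = 4 * card C"
      unfolding card_C by (simp add: power2_eq_square power3_eq_cube algebra_simps)
    finally show "k \<le> card C" using D(1) by simp
  qed
  \<comment> \<open>By \<open>card_C\<close> the division by 4 is exact.\<close>
  then show ?thesis
    using card_C by (simp add: N_def)
qed

end
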